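(* Let $n$ and $\Delta\ge 3$ be integers and let $T$ be a tree with $n$ vertices and maximum degree $\Delta$. Then $$TW(T)\ge (n-1)(\Delta-1),$$ with equality if and only if $T$ is starlike (of order $n$ with maximum degree $\Delta$).
   Context: A pendent vertex is a vertex of degree $1$; the terminal Wiener index $TW(T)$ of a tree $T$ is the sum of distances over all unordered pairs of distinct pendent vertices of $T$. A tree is starlike of degree $k$ if exactly one of its vertices has degree greater than two, and that degree equals $k\ge 3$. *)

theory Defs
  imports "Graph_Theory.Graph_Theory"
begin

text \<open>
  A finite simple undirected graph is represented, as in the library, by a finite symmetric digraph
  without loops and parallel arcs (locale \<^locale>\<open>graph\<close>): an edge is a pair of opposite arcs, so
  the undirected degree of a vertex is its out-degree.
\<close>

abbreviation deg :: "('a, 'b) pre_digraph \<Rightarrow> 'a \<Rightarrow> nat" where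
  "deg G v \<equiv> out_degree G v"

definition max_deg :: "('a, 'b) pre_digraph \<Rightarrow> nat" where
  "max_deg G = Max (deg G ` verts G)"

text \<open>
  The library predicate \<^const>\<open>tree\<close> is not suitable here: in a symmetric digraph it counts every
  edge, traversed back and forth, as a directed cycle of length 2. As there are neither loops nor
  parallel arcs, the directed cycles of length at least 3 are exactly the cycles of the undirected
  graph.
\<close>

definition undirected_tree :: "('a, 'b) pre_digraph \<Rightarrow> bool" where
  "undirected_tree G \<longleftrightarrow>
     graph G \<and> Digraph_Component.connected G \<and> \<not> (\<exists>p. pre_digraph.cycle G p \<and> length p \<ge> 3)"

text \<open>
  The minimum in the distance exists when \<open>u\<close> and \<open>v\<close> are connected, so always in a tree; otherwise
  the value is the arbitrary default of \<^const>\<open>Inf\<close> on natural numbers. The lemma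
  \<open>graph_dist_conv_\<mu>\<close> below relates it to the weighted distance of the library.
\<close>

definition graph_dist :: "('a, 'b) pre_digraph \<Rightarrow> 'a \<Rightarrow> 'a \<Rightarrow> nat" where
  "graph_dist G u v = Inf {length p | p. pre_digraph.awalk G u p v}"

text \<open>Well defined on two-element sets since the distance is symmetric; see \<open>pair_dist_doubleton\<close>.\<close>

definition pair_dist :: "('a, 'b) pre_digraph \<Rightarrow> 'a set \<Rightarrow> nat" where
  "pair_dist G P = (THE d. \<exists>u v. P = {u, v} \<and> d = graph_dist G u v)"

definition pendent_verts :: "('a, 'b) pre_digraph \<Rightarrow> 'a set" where
  "pendent_verts G = {v \<in> verts G. deg G v = 1}"

definition terminal_wiener :: "('a, 'b) pre_digraph \<Rightarrow> nat" where
  "terminal_wiener G = (\<Sum>P \<in> {P. P \<subseteq> pendent_verts G \<and> card P = 2}. pair_dist G P)"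

definition starlike :: "('a, 'b) pre_digraph \<Rightarrow> nat \<Rightarrow> bool" where
  "starlike G k \<longleftrightarrow> undirected_tree G \<and> k \<ge> 3 \<and>
     (\<exists>!v. v \<in> verts G \<and> deg G v > 2) \<and> (\<forall>v \<in> verts G. deg G v > 2 \<longrightarrow> deg G v = k)"

lemma (in sym_digraph) awalk_reverse_ex:
  assumes "awalk u p v"
  shows "\<exists>q. awalk v q u \<and> length q = length p"
  using assms
proof (induction p arbitrary: u)
  case Nil
  then show ?case by (auto simp: awalk_Nil_iff)
next
  case (Cons e p)
  then have e: "e \<in> arcs G" "tail G e = u" and p: "awalk (head G e) p v"
    by (auto simp: awalk_Cons_iff)
  obtain q where q: "awalk v q (head G e)" "length q = length p"
    using Cons.IH[OF p] by blast
  obtain f where f: "f \<in> arcs G" "tail G f = head G e" "head G f = u"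
    using sym_arcs e unfolding symmetric_conv by metis
  have "awalk (head G e) [f] u"
    using f arc_implies_awalk by metis
  then have "awalk v (q @ [f]) u"
    using q(1) by (rule awalk_appendI[rotated])
  then show ?case using q(2) by (intro exI[of _ "q @ [f]"]) auto
qed

lemma (in sym_digraph) graph_dist_sym: "graph_dist G u v = graph_dist G v u"
proof -
  have "{length p | p. awalk u p v} = {length p | p. awalk v p u}"
    using awalk_reverse_ex by (auto; metis)
  then show ?thesis by (simp add: graph_dist_def)
qed

lemma (in sym_digraph) pair_dist_doubleton: "pair_dist G {u, v} = graph_dist G u v"
  unfolding pair_dist_def
  by (rule the_equality) (auto simp: doubleton_eq_iff graph_dist_sym)

lemma (in wf_digraph) graph_dist_conv_\<mu>:
  assumes "u \<rightarrow>\<^sup>* v"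
  shows "ereal (real (graph_dist G u v)) = \<mu> (\<lambda>_. 1) u v"
proof -
  have cost: "awalk_cost (\<lambda>_. 1) p = real (length p)" for p :: "'b awalk"
    by (induction p) auto
  have ne: "{length p | p. awalk u p v} \<noteq> {}"
    using assms by (auto simp: reachable_awalk)
  obtain p where p: "awalk u p v" "graph_dist G u v = length p"
    using Inf_nat_def1[OF ne] by (auto simp: graph_dist_def)
  have "graph_dist G u v \<le> length q" if "awalk u q v" for q
    unfolding graph_dist_def by (rule cInf_lower) (use that in auto)
  then show ?thesis
    unfolding \<mu>_def cost using p by (intro antisym INF_greatest INF_lower2[of p]) auto
qed

end

theory Submission
  imports Defs
begin

text \<open>
  Root the tree at a vertex of maximum degree. Every edge joins a vertex \<open>w\<close> other than the root to
  its parent, and the distance of two vertices counts the \<open>w\<close> above exactly one of them. If there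
  are \<open>k\<close> leaves and \<open>l w\<close> of them lie below \<open>w\<close>, then the terminal Wiener index is
  \<open>\<Sum>w. l w * (k - l w)\<close>. As \<open>1 \<le> l w < k\<close>, each of the \<open>n - 1\<close> summands is at least \<open>k - 1\<close>. Counting
  children gives \<open>k = \<Delta> + \<Sum>(deg v - 2)\<close>, where \<open>v\<close> ranges over the inner vertices other than the
  root, so \<open>k \<ge> \<Delta>\<close> with equality iff the tree is starlike. In the latter case each of the \<open>\<Delta>\<close> branches
  at the root has exactly one leaf, that is, \<open>l w = 1\<close> for all \<open>w\<close>.
\<close>

section \<open>Finite rooted trees\<close>

text \<open>The counting needs only a parent relation \<open>P\<close> and a depth \<open>d\<close>.
  Since \<open>d\<close> grows by one along \<open>P\<close>, acyclicity and reachability from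
  \<open>r\<close> follow, and \<open>d\<close> serves as the induction measure.\<close>

locale rooted_tree =
  fixes V :: "'a set" and r :: 'a and P :: "('a \<times> 'a) set" and d :: "'a \<Rightarrow> nat"
  assumes finite_V: "finite V"
    and root_in_V: "r \<in> V"
    and P_in_V: "(x, y) \<in> P \<Longrightarrow> x \<in> V \<and> y \<in> V"
    and d_child: "(x, y) \<in> P \<Longrightarrow> d y = Suc (d x)"
    and parent_exists: "\<lbrakk>y \<in> V; y \<noteq> r\<rbrakk> \<Longrightarrow> \<exists>x. (x, y) \<in> P"
    and parent_unique: "\<lbrakk>(x, y) \<in> P; (x', y) \<in> P\<rbrakk> \<Longrightarrow> x = x'"
    and root_no_parent: "(x, r) \<notin> P"
begin

definition children :: "'a \<Rightarrow> 'a set" where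
  "children v = {c. (v, c) \<in> P}"

text \<open>Each vertex other than \<open>r\<close> stands for the edge to its parent. Thus
  \<open>above u\<close> encodes the edges on the path from \<open>r\<close> to \<open>u\<close>,
  which is why \<open>u\<close> belongs to it and \<open>r\<close> does not.\<close>

definition above :: "'a \<Rightarrow> 'a set" where
  "above u = {w \<in> V - {r}. (w, u) \<in> P\<^sup>*}"

definition leaves :: "'a set" where
  "leaves = {v \<in> V - {r}. children v = {}}"

text \<open>The \<open>l w\<close> of the overview: the number of leaves cut off from
  \<open>r\<close> by removing the edge between \<open>w\<close> and its parent.\<close>

definition weight :: "'a \<Rightarrow> nat" where
  "weight w = card {u \<in> leaves. w \<in> above u}"

section \<open>Ancestors, and the branches at the root\<close>

lemma children_subset: "children v \<subseteq> V - {r}"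
  using P_in_V root_no_parent by (auto simp: children_def)

lemma above_subset: "above u \<subseteq> V - {r}"
  by (auto simp: above_def)

lemma finite_children [simp]: "finite (children v)"
  using children_subset finite_V by (meson finite_Diff finite_subset)

lemma finite_above [simp]: "finite (above u)"
  using above_subset finite_V by (meson finite_Diff finite_subset)

lemma finite_leaves [simp]: "finite leaves"
  using finite_V by (simp add: leaves_def)

lemma d_mono: "(w, u) \<in> P\<^sup>* \<Longrightarrow> w = u \<or> d w < d u"
  by (induction rule: rtrancl_induct) (auto dest: d_child)

lemma above_root [simp]: "above r = {}"
  using root_no_parent by (auto simp: above_def rtrancl.simps[of _ r])

lemma above_child:
  assumes "(x, y) \<in> P"
  shows "above y = insert y (above x)"
proof -
  have "(w, y) \<in> P\<^sup>* \<longleftrightarrow> w = y \<or> (w, x) \<in> P\<^sup>*" for w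
    using assms parent_unique by (metis rtrancl.simps)
  moreover have "y \<in> V" "y \<noteq> r" using assms P_in_V root_no_parent by auto
  ultimately show ?thesis by (auto simp: above_def)
qed

lemma above_child_fresh: "(x, y) \<in> P \<Longrightarrow> y \<notin> above x"
  using d_mono[of y x] d_child[of x y] by (auto simp: above_def)

lemma above_self: "\<lbrakk>w \<in> V; w \<noteq> r\<rbrakk> \<Longrightarrow> w \<in> above w"
  by (simp add: above_def)

lemma above_trans: "\<lbrakk>v \<in> above w; w \<in> above u\<rbrakk> \<Longrightarrow> v \<in> above u"
  using rtrancl_trans[of v w P u] by (simp add: above_def)

lemma above_d_le: "w \<in> above u \<Longrightarrow> w = u \<or> d w < d u"
  using d_mono by (auto simp: above_def)

text \<open>As parents are unique, two nontrivial chains ending in the same vertex share their last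
  step; induction moves up one of them.\<close>

lemma ancestors_comparable:
  assumes "(w, u) \<in> P\<^sup>*" "(w', u) \<in> P\<^sup>*"
  shows "(w, w') \<in> P\<^sup>* \<or> (w', w) \<in> P\<^sup>*"
  using assms
proof (induction rule: rtrancl_induct)
  case base
  then show ?case by simp
next
  case (step x y)
  show ?case
  proof (cases "w' = y")
    case True
    then show ?thesis using step by (meson rtrancl_into_rtrancl)
  next
    case False
    then obtain z where "(w', z) \<in> P\<^sup>*" "(z, y) \<in> P"
      using step.prems by (meson rtranclE)
    then show ?thesis using step parent_unique by metis
  qed
qed

text \<open>Two children of \<open>r\<close> above the same vertex are comparable, and comparable
  vertices of equal depth coincide.\<close>

lemma root_child_above_unique:
  assumes "c \<in> children r" "c' \<in> children r" "c \<in> above u" "c' \<in> above u"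
  shows "c = c'"
  using ancestors_comparable[of c u c'] assms d_mono[of c c'] d_mono[of c' c]
    d_child[of r c] d_child[of r c']
  by (auto simp: above_def children_def)

lemma root_child_above_exists:
  assumes "v \<in> V" "v \<noteq> r"
  shows "\<exists>c \<in> children r. c \<in> above v"
  using assms
proof (induction "d v" arbitrary: v rule: less_induct)
  case less
  obtain x where x: "(x, v) \<in> P" using parent_exists less.prems by blast
  show ?case
  proof (cases "x = r")
    case True
    then show ?thesis using x less.prems above_self by (auto simp: children_def)
  next
    case False
    have "\<exists>c \<in> children r. c \<in> above x"
      by (rule less.hyps) (use x False d_child P_in_V in auto)
    then show ?thesis using above_child[OF x] by auto
  qed
qed

text \<open>A deepest vertex below \<open>w\<close> cannot have a child.\<close>

lemma leaf_below:
  assumes "w \<in> V" "w \<noteq> r"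
  shows "\<exists>u \<in> leaves. w \<in> above u"
proof -
  let ?B = "{u \<in> V. w \<in> above u}"
  have "finite ?B" "?B \<noteq> {}"
    using finite_V above_self assms by auto
  then obtain u where u: "u \<in> ?B" "\<And>x. x \<in> ?B \<Longrightarrow> d x \<le> d u"
    using Max_in[of "d ` ?B"] Max_ge[of "d ` ?B"]
    by (smt (verit) finite_imageI image_iff image_is_empty)
  have "u \<noteq> r" using u(1) by auto
  moreover have "(u, c) \<notin> P" for c
  proof
    assume c: "(u, c) \<in> P"
    then have "c \<in> ?B" using u(1) above_child P_in_V by auto
    then show False using u(2)[of c] d_child[OF c] by simp
  qed
  ultimately show ?thesis using u(1) by (auto simp: leaves_def children_def)
qed

section \<open>Counting leaves below vertices\<close>

lemma weight_pos: "\<lbrakk>w \<in> V; w \<noteq> r\<rbrakk> \<Longrightarrow> 1 \<le> weight w"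
  using leaf_below[of w] by (auto simp: weight_def Suc_le_eq card_gt_0_iff)

text \<open>All leaves below \<open>w\<close> lie in one branch at \<open>r\<close>, while a second
  branch contributes a leaf of its own.\<close>

lemma weight_less:
  assumes "w \<in> V" "w \<noteq> r" "2 \<le> card (children r)"
  shows "weight w < card leaves"
proof -
  obtain c where c: "c \<in> children r" "c \<in> above w"
    using root_child_above_exists assms by blast
  have "\<not> children r \<subseteq> {c}"
    using assms(3) card_mono[of "{c}" "children r"] by auto
  then obtain c' where c': "c' \<in> children r" "c' \<noteq> c" by blast
  then obtain u where "u \<in> leaves" "c' \<in> above u"
    using leaf_below[of c'] children_subset[of r] by blast
  then have "u \<in> leaves" "w \<notin> above u"
    using c c' above_trans root_child_above_unique by blast+
  then show ?thesis
    unfolding weight_def by (intro psubset_card_mono) auto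
qed

lemma sum_card_children: "(\<Sum>v\<in>V. card (children v)) = card V - 1"
proof -
  have "(\<Sum>v\<in>V. card (children v)) = card (\<Union>v\<in>V. children v)"
    using parent_unique
    by (intro card_UN_disjoint[symmetric]) (simp_all add: finite_V, auto simp: children_def)
  also have "(\<Union>v\<in>V. children v) = V - {r}"
    using parent_exists P_in_V root_no_parent by (auto simp: children_def) blast
  finally show ?thesis using finite_V root_in_V by simp
qed

text \<open>The vertices other than \<open>r\<close> are counted twice: as children of some vertex,
  and as leaves plus inner vertices. For an inner vertex other than the root,
  \<open>card (children v) - 1\<close> will be the degree minus two.\<close>

lemma card_leaves:
  assumes "children r \<noteq> {}"
  shows "card leaves = card (children r) + (\<Sum>v \<in> V - {r} - leaves. card (children v) - 1)"
proof -
  let ?N = "V - {r} - leaves"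
  have "finite ?N" and leaves: "leaves \<subseteq> V - {r}"
    using finite_V by (auto simp: leaves_def)
  have "card V - 1 = card (children r) + (\<Sum>v \<in> V - {r}. card (children v))"
    using sum_card_children sum.remove[OF finite_V root_in_V] by metis
  also have "(\<Sum>v \<in> V - {r}. card (children v)) = (\<Sum>v \<in> ?N. card (children v))"
    by (rule sum.mono_neutral_right) (use finite_V in \<open>auto simp: leaves_def\<close>)
  \<comment> \<open>The truncated subtraction is exact because inner vertices have a child.\<close>
  also have "\<dots> = (\<Sum>v \<in> ?N. (card (children v) - 1) + 1)"
  proof (rule sum.cong[OF refl])
    fix v assume "v \<in> ?N"
    then have "card (children v) > 0" by (auto simp: leaves_def card_gt_0_iff)
    then show "card (children v) = card (children v) - 1 + 1" by simp
  qed
  also have "\<dots> = (\<Sum>v \<in> ?N. card (children v) - 1) + card ?N"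
    by (simp only: sum.distrib card_eq_sum)
  finally have "card V - 1 = card (children r) + (\<Sum>v \<in> ?N. card (children v) - 1) + card ?N"
    by simp
  moreover have "card V - 1 = card leaves + card ?N"
    using card_Diff_subset[OF finite_leaves leaves] card_mono[OF _ leaves] finite_V root_in_V
    by simp
  ultimately show ?thesis by simp
qed

text \<open>The branches at \<open>r\<close> partition the leaves.\<close>

lemma sum_weight_root_children: "(\<Sum>c \<in> children r. weight c) = card leaves"
proof -
  have "(\<Sum>c \<in> children r. weight c) = card (\<Union>c \<in> children r. {u \<in> leaves. c \<in> above u})"
    unfolding weight_def
    by (rule card_UN_disjoint[symmetric]) (auto dest: root_child_above_unique)
  also have "(\<Union>c \<in> children r. {u \<in> leaves. c \<in> above u}) = leaves"
    using root_child_above_exists by (auto simp: leaves_def)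
  finally show ?thesis .
qed

text \<open>As many positive weights as \<open>r\<close> has children sum to the number of children,
  so each is 1. Any other \<open>w\<close> has at most the weight of the child of \<open>r\<close>
  above it.\<close>

lemma weight_eq_1:
  assumes k: "card leaves = card (children r)" and w: "w \<in> V" "w \<noteq> r"
  shows "weight w = 1"
proof -
  have pos: "1 \<le> weight c" if "c \<in> children r" for c
    using that children_subset[of r] weight_pos by blast
  obtain c where c: "c \<in> children r" "c \<in> above w"
    using root_child_above_exists w by blast
  have "\<not> 1 < weight c"
  proof
    assume "1 < weight c"
    then have "(\<Sum>c \<in> children r. 1) < (\<Sum>c \<in> children r. weight c)"
      by (intro sum_strict_mono_ex1) (use c pos in auto)
    then show False using k sum_weight_root_children by simp
  qed
  moreover have "weight w \<le> weight c"
    unfolding weight_def using c(2) by (intro card_mono) (auto intro: above_trans)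
  ultimately show ?thesis using weight_pos[OF w] by simp
qed

text \<open>Double counting: \<open>w\<close> lies in the symmetric difference exactly when one of
  \<open>u\<close>, \<open>v\<close> is a leaf below \<open>w\<close> and the other is not. The
  factor 2 comes from ordered pairs.\<close>

lemma sum_card_above_symdiff:
  "(\<Sum>u\<in>leaves. \<Sum>v\<in>leaves. card (sym_diff (above u) (above v))) =
   2 * (\<Sum>w \<in> V - {r}. weight w * (card leaves - weight w))"
proof -
  let ?W = "V - {r}" and ?k = "card leaves"
  \<comment> \<open>\<open>?\<chi> w u v\<close> indicates that the edge above \<open>w\<close>
    separates \<open>u\<close> from \<open>v\<close>.\<close>
  let ?\<chi> = "\<lambda>w u v. if (w \<in> above u) = (w \<in> above v) then 0 else 1 :: nat"
  have "card (sym_diff (above u) (above v)) = (\<Sum>w\<in>?W. ?\<chi> w u v)" for u v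
  proof -
    have "sym_diff (above u) (above v)
        = {w \<in> ?W. (w \<in> above u) \<noteq> (w \<in> above v)}"
      using above_subset by auto
    then have "card (sym_diff (above u) (above v)) =
        (\<Sum>w\<in>?W. if (w \<in> above u) \<noteq> (w \<in> above v) then 1 else 0)"
      using finite_V by (simp only: card_eq_sum sum.inter_filter finite_Diff)
    also have "\<dots> = (\<Sum>w\<in>?W. ?\<chi> w u v)" by (rule sum.cong) auto
    finally show ?thesis .
  qed
  then have "(\<Sum>u\<in>leaves. \<Sum>v\<in>leaves. card (sym_diff (above u) (above v)))
      = (\<Sum>u\<in>leaves. \<Sum>v\<in>leaves. \<Sum>w\<in>?W. ?\<chi> w u v)"
    by simp
  also have "\<dots> = (\<Sum>u\<in>leaves. \<Sum>w\<in>?W. \<Sum>v\<in>leaves. ?\<chi> w u v)"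
    by (intro sum.cong refl sum.swap)
  also have "\<dots> = (\<Sum>w\<in>?W. \<Sum>u\<in>leaves. \<Sum>v\<in>leaves. ?\<chi> w u v)"
    by (rule sum.swap)
  also have "\<dots> = (\<Sum>w\<in>?W. 2 * (weight w * (?k - weight w)))"
  proof (rule sum.cong[OF refl])
    fix w
    let ?A = "{u \<in> leaves. w \<in> above u}" and ?B = "{u \<in> leaves. w \<notin> above u}"
    have B: "card ?B = ?k - weight w"
    proof -
      have "?B = leaves - ?A" by auto
      then show ?thesis by (simp add: weight_def card_Diff_subset)
    qed
    have inner: "(\<Sum>v\<in>leaves. ?\<chi> w u v) = (if w \<in> above u then card ?B else card ?A)" for u
    proof -
      have "(\<Sum>v\<in>leaves. ?\<chi> w u v) = card (leaves \<inter> - {v. (w \<in> above u) = (w \<in> above v)})"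
        by (subst sum.If_cases) simp_all
      also have "leaves \<inter> - {v. (w \<in> above u) = (w \<in> above v)} = (if w \<in> above u then ?B else ?A)"
        by auto
      finally show ?thesis by (simp only: if_distrib[of card])
    qed
    have "(\<Sum>u\<in>leaves. \<Sum>v\<in>leaves. ?\<chi> w u v)
        = (\<Sum>u\<in>leaves. if w \<in> above u then card ?B else card ?A)"
      by (simp only: inner)
    also have "\<dots> = card ?A * card ?B + card ?B * card ?A"
      by (subst sum.If_cases) (auto simp: Int_def)
    also have "\<dots> = 2 * (weight w * (?k - weight w))"
      unfolding B by (simp add: weight_def)
    finally show "(\<Sum>u\<in>leaves. \<Sum>v\<in>leaves. ?\<chi> w u v) = 2 * (weight w * (?k - weight w))" .
  qed
  finally show ?thesis by (simp add: sum_distrib_left)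
qed

end

section \<open>Distances and sums over pairs\<close>

context wf_digraph
begin

lemma graph_dist_le: "awalk u p v \<Longrightarrow> graph_dist G u v \<le> length p"
  unfolding graph_dist_def by (rule cInf_lower) auto

lemma graph_dist_awalk:
  assumes "u \<rightarrow>\<^sup>* v"
  obtains p where "awalk u p v" "length p = graph_dist G u v"
proof -
  have "{length p | p. awalk u p v} \<noteq> {}"
    using assms by (auto simp: reachable_awalk)
  from Inf_nat_def1[OF this] show ?thesis
    using that by (auto simp: graph_dist_def)
qed

lemma awalk_snoc_iff:
  "awalk u (p @ [e]) v \<longleftrightarrow> awalk u p (tail G e) \<and> e \<in> arcs G \<and> head G e = v"
proof
  assume "awalk u (p @ [e]) v"
  then have "awalk u p (awlast u p)" "awalk (awlast u p) [e] v" by simp_all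
  then show "awalk u p (tail G e) \<and> e \<in> arcs G \<and> head G e = v"
    by (metis awalk_Cons_iff awalk_Nil_iff)
next
  assume "awalk u p (tail G e) \<and> e \<in> arcs G \<and> head G e = v"
  then show "awalk u (p @ [e]) v"
    using awalk_appendI arc_implies_awalk by blast
qed

lemma graph_dist_adj_le:
  assumes "u \<rightarrow>\<^sup>* x" "x \<rightarrow> y"
  shows "graph_dist G u y \<le> Suc (graph_dist G u x)"
proof -
  obtain p where p: "awalk u p x" "length p = graph_dist G u x"
    using graph_dist_awalk assms(1) by blast
  obtain e where "e \<in> arcs G" "tail G e = x" "head G e = y"
    using assms(2) by auto
  then have "awalk u (p @ [e]) y" using p(1) awalk_snoc_iff by metis
  from graph_dist_le[OF this] p(2) show ?thesis by simp
qed

text \<open>Dropping the last arc of a shortest walk gives a shortest walk to its tail. This will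
  supply the parents.\<close>

lemma graph_dist_pred:
  assumes "u \<rightarrow>\<^sup>* y" "y \<noteq> u"
  shows "\<exists>x. x \<rightarrow> y \<and> graph_dist G u y = Suc (graph_dist G u x)"
proof -
  obtain p where p: "awalk u p y" "length p = graph_dist G u y"
    using graph_dist_awalk assms(1) by blast
  have "p \<noteq> []" using p(1) assms(2) by (auto simp: awalk_Nil_iff)
  then obtain q e where "p = q @ [e]" by (cases p rule: rev_cases) auto
  then have q: "awalk u q (tail G e)" "e \<in> arcs G" "head G e = y" "p = q @ [e]"
    using p(1) awalk_snoc_iff by auto
  have "tail G e \<rightarrow> y" using q by (auto dest: in_arcs_imp_in_arcs_ends)
  moreover have "graph_dist G u y \<le> Suc (graph_dist G u (tail G e))"
    using graph_dist_adj_le q(1) calculation reachable_awalk by blast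
  moreover have "graph_dist G u (tail G e) \<le> length q" by (rule graph_dist_le[OF q(1)])
  ultimately show ?thesis using p(2) q(4) by (intro exI[of _ "tail G e"]) auto
qed

end

text \<open>Without parallel arcs, \<open>head G\<close> is injective on the arcs leaving
  \<open>v\<close>, so degrees can be read off neighbour sets.\<close>

lemma (in nomulti_digraph) out_degree_eq_card: "out_degree G v = card (arcs_ends G `` {v})"
proof -
  have "inj_on (head G) (out_arcs G v)"
    by (rule inj_onI) (auto simp: out_arcs_def arc_to_ends_def intro: no_multi_arcs)
  moreover have "head G ` out_arcs G v = arcs_ends G `` {v}"
    by (auto simp: out_arcs_def arcs_ends_conv)
  ultimately show ?thesis unfolding out_degree_def by (metis card_image)
qed

text \<open>Passes from unordered to ordered pairs. By induction on \<open>L\<close>: a new element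
  \<open>a\<close> adds the sets \<open>{a, v}\<close>, which the double sum counts as
  \<open>f a v\<close> and \<open>f v a\<close>; the diagonal vanishes.\<close>

lemma sum_two_subsets:
  fixes f :: "'a \<Rightarrow> 'a \<Rightarrow> nat"
  assumes "finite L" and f: "\<And>u v. f u v = f v u" "\<And>u. u \<in> L \<Longrightarrow> f u u = 0"
    and g: "\<And>u v. g {u, v} = f u v"
  shows "2 * (\<Sum>Q \<in> {Q. Q \<subseteq> L \<and> card Q = 2}. g Q) = (\<Sum>u\<in>L. \<Sum>v\<in>L. f u v)"
  using assms(1) f(2)
proof (induction L)
  case empty
  then show ?case by (auto intro: sum.neutral)
next
  case (insert a L)
  let ?Q = "\<lambda>L. {Q. Q \<subseteq> L \<and> card Q = 2}"
  have "?Q (insert a L) = ?Q L \<union> (\<lambda>v. {a, v}) ` L"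
  proof (intro equalityI subsetI)
    fix Q assume Q: "Q \<in> ?Q (insert a L)"
    show "Q \<in> ?Q L \<union> (\<lambda>v. {a, v}) ` L"
    proof (cases "a \<in> Q")
      case True
      then obtain v where "Q = {a, v}" "a \<noteq> v"
        using Q by (auto simp: card_2_iff doubleton_eq_iff)
      then show ?thesis using Q by auto
    qed (use Q in auto)
  next
    fix Q assume "Q \<in> ?Q L \<union> (\<lambda>v. {a, v}) ` L"
    then show "Q \<in> ?Q (insert a L)" using insert.hyps by (auto simp: card_2_iff)
  qed
  moreover have "?Q L \<inter> (\<lambda>v. {a, v}) ` L = {}" using insert.hyps by auto
  moreover have "finite (?Q L)" using insert.hyps by simp
  moreover have "(\<Sum>Q \<in> (\<lambda>v. {a, v}) ` L. g Q) = (\<Sum>v\<in>L. f a v)"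
    by (subst sum.reindex) (auto simp: g inj_on_def doubleton_eq_iff)
  ultimately have "sum g (?Q (insert a L)) = sum g (?Q L) + (\<Sum>v\<in>L. f a v)"
    using insert.hyps by (simp add: sum.union_disjoint)
  moreover have "(\<Sum>v\<in>L. f v a) = (\<Sum>v\<in>L. f a v)" using f(1) by simp
  ultimately show ?case
    using insert by (simp add: sum.distrib)
qed

section \<open>Rooting an undirected tree\<close>

text \<open>The bound 3 still permits the directed cycles of length two that an edge forms with its
  reversal.\<close>

locale rooted_graph = graph G for G :: "('a, 'b) pre_digraph" (structure) +
  fixes r :: 'a
  assumes r_in_verts: "r \<in> verts G"
    and root_reachable: "\<And>v. v \<in> verts G \<Longrightarrow> r \<rightarrow>\<^sup>* v"
    and no_long_cycle: "\<And>p. cycle p \<Longrightarrow> length p < 3"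
begin

abbreviation d :: "'a \<Rightarrow> nat" where
  "d v \<equiv> graph_dist G r v"

definition parent_rel :: "('a \<times> 'a) set" where
  "parent_rel = {(x, y). x \<rightarrow> y \<and> d y = Suc (d x)}"

section \<open>Unique parents from the absence of long cycles\<close>

lemma adj_sym: "x \<rightarrow> y \<Longrightarrow> y \<rightarrow> x"
  using arcs_ends_symmetric sym_arcs by metis

lemma d_root: "d r = 0"
  using graph_dist_le[of r "[]" r] r_in_verts by (simp add: awalk_Nil_iff)

text \<open>The vertices before \<open>x\<close> on a shortest walk from \<open>r\<close> have depth
  less than \<open>d x\<close>, hence less than \<open>d v\<close>, so the walk avoids
  \<open>v\<close>.\<close>

lemma root_reachable_del_vert:
  assumes "x \<in> verts G" "x \<noteq> v" "d x \<le> d v"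
  shows "r \<rightarrow>\<^sup>*\<^bsub>del_vert v\<^esub> x"
  using assms
proof (induction "d x" arbitrary: x rule: less_induct)
  case less
  interpret H: wf_digraph "del_vert v" by (rule wf_digraph_del_vert)
  show ?case
  proof (cases "x = r")
    case True
    then show ?thesis using less.prems by (auto simp: del_vert_simps)
  next
    case False
    then obtain z where z: "z \<rightarrow> x" "d x = Suc (d z)"
      using graph_dist_pred root_reachable less.prems by metis
    then have "z \<noteq> v" "z \<in> verts G" using less.prems adj_in_verts by auto
    then have "r \<rightarrow>\<^sup>*\<^bsub>del_vert v\<^esub> z" using less.hyps z less.prems by simp
    moreover have "z \<rightarrow>\<^bsub>del_vert v\<^esub> x"
      using z(1) \<open>z \<noteq> v\<close> less.prems by (auto simp: arcs_ends_conv del_vert_simps)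
    ultimately show ?thesis by (rule H.reachable_adj_trans)
  qed
qed

text \<open>Two such neighbours would be joined through \<open>r\<close> by a path avoiding
  \<open>v\<close>; closing it through \<open>v\<close> gives a cycle of length at least 3. This
  yields both unique parents and the absence of edges within a depth level.\<close>

lemma nondeeper_neighbour_unique:
  assumes x: "v \<rightarrow> x" "d x \<le> d v" and y: "v \<rightarrow> y" "d y \<le> d v"
  shows "x = y"
proof (rule ccontr)
  assume "x \<noteq> y"
  interpret H: wf_digraph "del_vert v" by (rule wf_digraph_del_vert)
  have ne: "x \<noteq> v" "y \<noteq> v" using x y adj_not_same by auto
  have symH: "symmetric (del_vert v)"
    using sym_arcs unfolding symmetric_conv by (simp add: del_vert_simps) metis
  have "r \<rightarrow>\<^sup>*\<^bsub>del_vert v\<^esub> x" "r \<rightarrow>\<^sup>*\<^bsub>del_vert v\<^esub> y"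
    using root_reachable_del_vert ne x y adj_in_verts by blast+
  then have "x \<rightarrow>\<^sup>*\<^bsub>del_vert v\<^esub> y"
    using symmetric_reachable[OF symH] H.reachable_trans by blast
  then obtain p where p: "H.apath x p y" using H.reachable_apath by blast
  have "set (H.awalk_verts x p) \<subseteq> verts G - {v}"
    using p H.awalk_verts_in_verts H.awalkI_apath H.awalk_hd_in_verts
    by (metis verts_del_vert H.awalkE' subsetI)
  \<comment> \<open>The vertices of a walk depend only on \<open>tail\<close> and
    \<open>head\<close>, which deleting \<open>v\<close> leaves unchanged.\<close>
  moreover have "H.awalk_verts = awalk_verts"
    using subgraph_del_vert compatible_awalk_verts by (metis subgraph_def)
  ultimately have v: "v \<notin> set (awalk_verts x p)" by auto
  have path: "apath x p y"
    by (rule subgraph_apath_imp_apath[OF p subgraph_del_vert])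
  obtain e where e: "e \<in> arcs G" "tail G e = v" "head G e = x" using x(1) by auto
  obtain f where f: "f \<in> arcs G" "tail G f = y" "head G f = v" using adj_sym[OF y(1)] by auto
  have "awalk x (p @ [f]) v" "distinct (awalk_verts x (p @ [f]))"
    using path f v awalk_snoc_iff awalk_verts_append[of x p "[f]" v]
    by (auto simp: apath_def)
  then have "cycle (e # p @ [f])"
    using e by (auto simp: cycle_def awalk_Cons_iff)
  moreover have "p \<noteq> []" using path \<open>x \<noteq> y\<close> by (auto simp: apath_def awalk_Nil_iff)
  ultimately show False using no_long_cycle[of "e # p @ [f]"] by (cases p) auto
qed

text \<open>Adjacent depths differ by at most one. If they were equal, \<open>y\<close> and a
  predecessor \<open>z\<close> of \<open>x\<close> would be two neighbours of \<open>x\<close> that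
  are no deeper than \<open>x\<close>.\<close>

lemma adj_parent_rel:
  assumes "x \<rightarrow> y"
  shows "(x, y) \<in> parent_rel \<or> (y, x) \<in> parent_rel"
proof -
  have reach: "r \<rightarrow>\<^sup>* x" "r \<rightarrow>\<^sup>* y"
    using root_reachable adj_in_verts[OF assms] by auto
  have le: "d y \<le> Suc (d x)" "d x \<le> Suc (d y)"
    using graph_dist_adj_le[OF reach(1) assms] graph_dist_adj_le[OF reach(2) adj_sym[OF assms]]
    by auto
  have "d x \<noteq> d y"
  proof
    assume eq: "d x = d y"
    obtain z where z: "z \<rightarrow> x" "d x = Suc (d z)"
    proof (cases "x = r")
      \<comment> \<open>Here \<open>y\<close> would have depth 0, yet as a vertex other than
        \<open>r\<close> it has a predecessor.\<close>
      case True
      then have "y \<noteq> r" using assms adj_not_same by auto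
      then obtain z where "z \<rightarrow> y" "d y = Suc (d z)"
        using graph_dist_pred[OF reach(2)] by blast
      then show ?thesis using True eq d_root by simp
    next
      case False
      then show ?thesis
        using that graph_dist_pred[OF reach(1)] by blast
    qed
    have "d z \<le> d x" "d y \<le> d x" using z(2) eq by auto
    then have "z = y" using nondeeper_neighbour_unique[OF adj_sym[OF z(1)] _ assms] by blast
    then show False using eq z(2) by simp
  qed
  then show ?thesis using le assms adj_sym[OF assms] by (auto simp: parent_rel_def)
qed

sublocale rooted_tree "verts G" r parent_rel d
proof
  show "(x, r) \<notin> parent_rel" for x by (simp add: parent_rel_def d_root)
  show "x = x'" if "(x, y) \<in> parent_rel" "(x', y) \<in> parent_rel" for x y x'
    using that adj_sym by (intro nondeeper_neighbour_unique[of y]) (auto simp: parent_rel_def)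
  show "\<exists>x. (x, y) \<in> parent_rel" if "y \<in> verts G" "y \<noteq> r" for y
    using graph_dist_pred root_reachable that by (simp add: parent_rel_def)
qed (use r_in_verts adj_in_verts in \<open>auto simp: parent_rel_def\<close>)

lemma children_iff: "w \<in> children v \<longleftrightarrow> v \<rightarrow> w \<and> d w = Suc (d v)"
  unfolding children_def by (simp add: parent_rel_def)

lemma deg_root: "deg G r = card (children r)"
proof -
  have "r \<rightarrow> w \<longleftrightarrow> w \<in> children r" for w
    using adj_parent_rel[of r w] unfolding children_iff by (auto simp: parent_rel_def d_root)
  then have "arcs_ends G `` {r} = children r" by auto
  then show ?thesis by (simp add: out_degree_eq_card)
qed

text \<open>The successor accounts for the parent, the only neighbour that is not a child.\<close>

lemma deg_nonroot:
  assumes "v \<in> verts G" "v \<noteq> r"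
  shows "deg G v = Suc (card (children v))"
proof -
  obtain x where x: "(x, v) \<in> parent_rel" using parent_exists assms by blast
  have "v \<rightarrow> w \<longleftrightarrow> w = x \<or> w \<in> children v" for w
    using adj_parent_rel[of v w] parent_unique[OF x, of w] x adj_sym[of x v]
    unfolding children_iff by (auto simp: parent_rel_def)
  then have "arcs_ends G `` {v} = insert x (children v)" by auto
  moreover have "x \<notin> children v"
    using x unfolding children_iff by (simp add: parent_rel_def)
  ultimately show ?thesis by (simp add: out_degree_eq_card)
qed

section \<open>Distances as symmetric differences of ancestor sets\<close>

lemma card_above_symdiff_le:
  assumes "awalk u p v"
  shows "card (sym_diff (above u) (above v)) \<le> length p"
  using assms
proof (induction p arbitrary: u)
  case Nil
  then show ?case by (simp add: awalk_Nil_iff)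
next
  case (Cons e p)
  let ?D = "\<lambda>x y. sym_diff (above x) (above y)"
  let ?x = "head G e"
  have e: "e \<in> arcs G" "tail G e = u" and p: "awalk ?x p v"
    using Cons.prems by (auto simp: awalk_Cons_iff)
  have "u \<rightarrow> ?x" using e in_arcs_imp_in_arcs_ends by blast
  \<comment> \<open>An arc joins a parent and a child, whose ancestor sets differ in the child
    alone; \<open>z\<close> is that child.\<close>
  then obtain z where "?D u ?x \<subseteq> {z}"
    using adj_parent_rel[of u ?x] above_child[of u ?x] above_child[of ?x u] by blast
  then have "?D u v \<subseteq> insert z (?D ?x v)" by blast
  then have "card (?D u v) \<le> card (insert z (?D ?x v))" by (intro card_mono) auto
  also have "\<dots> \<le> Suc (card (?D ?x v))" by (simp add: card_insert_if)
  also have "\<dots> \<le> Suc (length p)" using Cons.IH[OF p] by simp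
  finally show ?case by simp
qed

text \<open>Stepping from the deeper end to its parent removes exactly one element from the
  symmetric difference.\<close>

lemma awalk_above_symdiff:
  assumes "u \<in> verts G" "v \<in> verts G"
  shows "\<exists>p. awalk u p v \<and> length p = card (sym_diff (above u) (above v))"
  using assms
proof (induction "d u + d v" arbitrary: u v rule: less_induct)
  case less
  let ?D = "\<lambda>x y. sym_diff (above x) (above y)"
  \<comment> \<open>Stated for arbitrary \<open>a\<close> and \<open>b\<close> so that it also
    covers the swapped pair, whose walk is then reversed.\<close>
  have climb: "\<exists>p. awalk a p b \<and> length p = card (?D a b)"
    if ab: "a \<in> verts G" "b \<in> verts G" "a \<noteq> b" "d b \<le> d a" "d a + d b = d u + d v" for a b
  proof -
    have "a \<noteq> r"
    proof
      assume "a = r"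
      then have "d b = 0" using ab d_root by simp
      then have "b = r" using parent_exists[of b] ab d_child by fastforce
      then show False using \<open>a = r\<close> ab by simp
    qed
    then obtain x where x: "(x, a) \<in> parent_rel" using parent_exists ab by blast
    have "x \<in> verts G" "d a = Suc (d x)" using P_in_V d_child x by blast+
    then obtain p where p: "awalk x p b" "length p = card (?D x b)"
      using less.hyps[of x b] ab by auto
    obtain e where "e \<in> arcs G" "tail G e = a" "head G e = x"
      using x adj_sym[of x a] by (auto simp: parent_rel_def)
    then have "awalk a (e # p) b" using p by (simp add: awalk_Cons_iff)
    \<comment> \<open>A proper ancestor of \<open>b\<close> would be strictly less deep than
      \<open>b\<close>.\<close>
    moreover have "a \<notin> above b" using above_d_le[of a b] ab by auto
    then have "?D a b = insert a (?D x b)" "a \<notin> ?D x b"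
      using above_child[OF x] above_child_fresh[OF x] by auto
    then have "card (?D a b) = Suc (card (?D x b))" by simp
    ultimately show ?thesis using p(2) by (intro exI[of _ "e # p"]) simp
  qed
  consider "u = v" | "u \<noteq> v" "d v \<le> d u" | "u \<noteq> v" "d u \<le> d v" by linarith
  then show ?case
  proof cases
    case 1
    then show ?thesis using less.prems by (intro exI[of _ "[]"]) (simp add: awalk_Nil_iff)
  next
    case 2
    then show ?thesis using climb less.prems by simp
  next
    case 3
    then obtain p where "awalk v p u" "length p = card (?D v u)"
      using climb[of v u] less.prems by auto
    then show ?thesis using awalk_reverse_ex[of v p u] by (auto simp: Un_commute)
  qed
qed

lemma graph_dist_eq_above:
  assumes "u \<in> verts G" "v \<in> verts G"
  shows "graph_dist G u v = card (sym_diff (above u) (above v))"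
proof -
  obtain p where p: "awalk u p v" "length p = card (sym_diff (above u) (above v))"
    using awalk_above_symdiff assms by blast
  have "u \<rightarrow>\<^sup>* v" using p(1) by (rule reachable_awalkI)
  then obtain q where "awalk u q v" "length q = graph_dist G u v" by (rule graph_dist_awalk)
  then show ?thesis
    using card_above_symdiff_le graph_dist_le[OF p(1)] p(2) by fastforce
qed

section \<open>The terminal Wiener index in terms of leaf counts\<close>

lemma pendent_verts_eq_leaves:
  assumes "2 \<le> card (children r)"
  shows "pendent_verts G = leaves"
proof -
  have "deg G v = 1 \<longleftrightarrow> v \<noteq> r \<and> children v = {}" if "v \<in> verts G" for v
    using that assms deg_root deg_nonroot by (cases "v = r") auto
  then show ?thesis by (auto simp: pendent_verts_def leaves_def)
qed

lemma terminal_wiener_eq_sum_weight: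
  assumes "2 \<le> card (children r)"
  shows "terminal_wiener G = (\<Sum>w \<in> verts G - {r}. weight w * (card leaves - weight w))"
proof -
  have "2 * terminal_wiener G = (\<Sum>u\<in>leaves. \<Sum>v\<in>leaves. graph_dist G u v)"
    unfolding terminal_wiener_def pendent_verts_eq_leaves[OF assms]
    by (rule sum_two_subsets)
      (auto simp: graph_dist_sym pair_dist_doubleton graph_dist_eq_above leaves_def finite_V)
  also have "\<dots> = (\<Sum>u\<in>leaves. \<Sum>v\<in>leaves. card (sym_diff (above u) (above v)))"
    by (intro sum.cong) (auto simp: graph_dist_eq_above leaves_def)
  finally show ?thesis using sum_card_above_symdiff by simp
qed

text \<open>By \<open>card_leaves\<close> the excess is a sum of natural numbers, which vanishes iff
  every inner vertex other than \<open>r\<close> has one child, that is, degree two.\<close>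

lemma card_leaves_eq_iff:
  assumes "2 \<le> card (children r)"
  shows "card leaves = card (children r) \<longleftrightarrow> (\<forall>v \<in> verts G. v \<noteq> r \<longrightarrow> deg G v \<le> 2)"
proof -
  have "children r \<noteq> {}" using assms by auto
  then have "card leaves = card (children r) \<longleftrightarrow>
      (\<forall>v \<in> verts G - {r} - leaves. card (children v) \<le> 1)"
    by (simp add: card_leaves)
  also have "\<dots> \<longleftrightarrow> (\<forall>v \<in> verts G. v \<noteq> r \<longrightarrow> deg G v \<le> 2)"
    using deg_nonroot by (auto simp: leaves_def)
  finally show ?thesis .
qed

lemma terminal_wiener_ge:
  assumes "2 \<le> card (children r)"
  shows "(card (verts G) - 1) * (card leaves - 1) \<le> terminal_wiener G"
proof -
  have "card leaves - 1 \<le> weight w * (card leaves - weight w)" if "w \<in> verts G - {r}" for w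
  proof -
    have "1 \<le> weight w" "weight w < card leaves"
      using weight_pos weight_less that assms by auto
    \<comment> \<open>With \<open>card leaves = a + b + 2\<close>, the product
      \<open>Suc a * Suc b\<close> exceeds \<open>card leaves - 1\<close> by
      \<open>a * b\<close>.\<close>
    then obtain a b where "weight w = Suc a" "card leaves - weight w = Suc b"
      by (metis Suc_diff_Suc not0_implies_Suc not_one_le_zero)
    then show ?thesis by simp
  qed
  then have "(\<Sum>w \<in> verts G - {r}. card leaves - 1) \<le> terminal_wiener G"
    unfolding terminal_wiener_eq_sum_weight[OF assms] by (rule sum_mono)
  then show ?thesis using r_in_verts by simp
qed

lemma terminal_wiener_eq:
  assumes "2 \<le> card (children r)" "card leaves = card (children r)"
  shows "terminal_wiener G = (card (verts G) - 1) * (card (children r) - 1)"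
  using r_in_verts weight_eq_1[OF assms(2)] assms(2)
  by (simp add: terminal_wiener_eq_sum_weight[OF assms(1)])

end

section \<open>The lower bound, with equality for starlike trees\<close>

theorem theorem4p4:
  fixes T :: "('a, 'b) pre_digraph" and n \<Delta> :: nat
  assumes "\<Delta> \<ge> 3"
    and "undirected_tree T"
    and "card (verts T) = n"
    and "max_deg T = \<Delta>"
  shows "int (terminal_wiener T) \<ge> (int n - 1) * (int \<Delta> - 1) \<and>
    (int (terminal_wiener T) = (int n - 1) * (int \<Delta> - 1) \<longleftrightarrow> starlike T \<Delta>)"
proof -
  have T: "graph T" "Digraph_Component.connected T"
    "\<And>p. pre_digraph.cycle T p \<Longrightarrow> length p < 3"
    using assms(2) by (auto simp: undirected_tree_def not_le)
  interpret graph T by (rule T(1))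
  \<comment> \<open>Connectedness is defined through the symmetric closure, which has the same
    reachability as the symmetric digraph \<open>T\<close>.\<close>
  have sc: "verts T \<noteq> {}" "\<And>u v. \<lbrakk>u \<in> verts T; v \<in> verts T\<rbrakk> \<Longrightarrow> u \<rightarrow>\<^sup>*\<^bsub>T\<^esub> v"
    using T(2) reachable_mk_symmetric_eq[OF sym_arcs]
    by (auto simp: Digraph_Component.connected_def strongly_connected_def)
  have "\<Delta> \<in> deg T ` verts T"
    using Max_in[OF finite_imageI[OF finite_verts], of "deg T"] sc(1) assms(4)
    unfolding max_deg_def by (metis image_is_empty)
  then obtain r where r: "r \<in> verts T" "deg T r = \<Delta>" by auto
  interpret rooted_graph T r
    by unfold_locales (use r sc T(3) in auto)
  have \<Delta>: "card (children r) = \<Delta>" "2 \<le> card (children r)"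
    using deg_root r assms(1) by auto
  have "children r \<noteq> {}" using \<Delta> by auto
  then have k: "\<Delta> \<le> card leaves" using card_leaves \<Delta>(1) by simp
  \<comment> \<open>This makes \<open>n - 1\<close> positive, so that it can be cancelled in the
    equality case, and makes the natural subtraction agree with the integer one.\<close>
  have "2 \<le> n"
    using card_mono[OF _ children_subset[of r]] finite_V r \<Delta> assms(3) by simp
  have int: "(int n - 1) * (int \<Delta> - 1) = int ((n - 1) * (\<Delta> - 1))"
    using \<open>2 \<le> n\<close> assms(1) by (simp add: of_nat_diff)
  have ge: "(n - 1) * (card leaves - 1) \<le> terminal_wiener T"
    using terminal_wiener_ge[OF \<Delta>(2)] assms(3) by simp
  have "(n - 1) * (\<Delta> - 1) \<le> (n - 1) * (card leaves - 1)"
    using k by (intro mult_le_mono) auto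
  then have lower: "(n - 1) * (\<Delta> - 1) \<le> terminal_wiener T"
    using ge by (rule le_trans)
  have "terminal_wiener T = (n - 1) * (\<Delta> - 1) \<longleftrightarrow> card leaves = \<Delta>"
  proof
    \<comment> \<open>Equality collapses both inequalities of the chain through
      \<open>(n - 1) * (card leaves - 1)\<close>.\<close>
    assume "terminal_wiener T = (n - 1) * (\<Delta> - 1)"
    then have "card leaves - 1 \<le> \<Delta> - 1" using ge \<open>2 \<le> n\<close> by simp
    then show "card leaves = \<Delta>" using k assms(1) by simp
  qed (use terminal_wiener_eq \<Delta> assms(3) in auto)
  also have "\<dots> \<longleftrightarrow> (\<forall>v \<in> verts T. v \<noteq> r \<longrightarrow> deg T v \<le> 2)"
    using card_leaves_eq_iff \<Delta> by simp
  also have "\<dots> \<longleftrightarrow> starlike T \<Delta>"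
  proof
    assume "\<forall>v \<in> verts T. v \<noteq> r \<longrightarrow> deg T v \<le> 2"
    then have only_r: "v = r" if "v \<in> verts T" "deg T v > 2" for v
      using that not_less by blast
    have "\<exists>!v. v \<in> verts T \<and> deg T v > 2"
    proof (rule ex1I[of _ r])
      show "r \<in> verts T \<and> deg T r > 2" using r assms(1) by simp
    qed (use only_r in blast)
    moreover have "deg T v = \<Delta>" if "v \<in> verts T" "deg T v > 2" for v
      using only_r[OF that] r(2) by simp
    ultimately show "starlike T \<Delta>"
      using assms(1,2) unfolding starlike_def by blast
  next
    assume "starlike T \<Delta>"
    then have "\<exists>!v. v \<in> verts T \<and> deg T v > 2" by (simp only: starlike_def)
    \<comment> \<open>The only vertex of degree above two must therefore be
      \<open>r\<close>.\<close>
    moreover have "r \<in> verts T \<and> deg T r > 2" using r assms(1) by simp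
    ultimately show "\<forall>v \<in> verts T. v \<noteq> r \<longrightarrow> deg T v \<le> 2" using not_less by metis
  qed
  finally show ?thesis using lower unfolding int of_nat_eq_iff of_nat_le_iff by simp
qed

end
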